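(* Consider the following distribution $\mathcal{P}_{\mathrm{finite}\text{-}\mathrm{hard}}$ with $m=2$ resources: the replenishment is deterministic, $\bm b_t=(1,1)$ for every $t$, and the order $(r_t,\bm a_t)$ equals $(R_i,\bm A_i)$ with probability $\mu_i$, where $\bm A_1=(2,2),R_1=5,\mu_1=\tfrac14$; $\bm A_2=(2,0),R_2=3,\mu_2=\tfrac18$; $\bm A_3=(0,2),R_3=3,\mu_3=\tfrac18$; $\bm A_4=(2,0),R_4=4,\mu_4=\tfrac18$; $\bm A_5=(0,2),R_5=4,\mu_5=\tfrac18$; $\bm A_6=(0,0),R_6=0,\mu_6=\tfrac14$, orders being i.i.d. across periods. There exist universal constants $T_{\mathrm{finite}\text{-}\mathrm{hard}}>0$ and $c>0$ such that for every $T>T_{\mathrm{finite}\text{-}\mathrm{hard}}$ and every feasible online policy $\bm\pi$ (even one that knows $\mathcal{P}_{\mathrm{finite}\text{-}\mathrm{hard}}$), $$\mathrm{Regret}_{\mathcal{P}_{\mathrm{finite}\text{-}\mathrm{hard}}}(\bm\pi)\ge c\sqrt T.$$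
   Context: Online linear programming with replenishment. There are $m$ resources and a horizon $T$. Tuples $(r_t,\bm{a}_t,\bm{b}_t)\in\mathbb{R}\times\mathbb{R}^m\times\mathbb{R}^m_{\geq 0}$, $t=1,\dots,T$, are drawn i.i.d. from a distribution $\mathcal{P}$. Inventory starts at $0$. In period $t$ each resource $j$ is first replenished by $b_{jt}$; then the order $(r_t,\bm{a}_t)$ is revealed and the decision maker chooses $x_t\in\{0,1\}$ (possibly at random) based only on $(r_k,\bm{a}_k,\bm{b}_k,x_k)_{k<t}$ and $(r_t,\bm{a}_t,\bm{b}_t)$. A policy is feasible if for every realization $\sum_{k\le t}a_{jk}x_k\le\sum_{k\le t}b_{jk}$ for all $j\in[m]$, $t\in[T]$. The hindsight optimum $R^*$ is the maximum of $\sum_t r_tx_t$ over $\bm x\in\{0,1\}^T$ subject to these prefix constraints, and $\mathrm{Regret}_{\mathcal{P}}(\bm{\pi})=\mathbb{E}[R^*-\sum_t r_tx_t]$. *)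

theory Defs
  imports Complex_Main
begin

text \<open>Order types are indexed 0..5 (paper's types 1..6).  Replenishment is
 deterministic b_t = (1,1), so the cumulative replenishment of each resource
 after t periods is t.\<close>

definition types :: "nat set" where "types = {..<6}"

definition rew :: "nat \<Rightarrow> real" where
  "rew i = [5, 3, 3, 4, 4, 0] ! i"

definition cons1 :: "nat \<Rightarrow> real" where
  "cons1 i = [2, 2, 0, 2, 0, 0] ! i"

definition cons2 :: "nat \<Rightarrow> real" where
  "cons2 i = [2, 0, 2, 0, 2, 0] ! i"

definition mu :: "nat \<Rightarrow> real" where
  "mu i = [1/4, 1/8, 1/8, 1/8, 1/8, 1/4] ! i"

definition ind :: "bool \<Rightarrow> real" where "ind b = (if b then 1 else 0)"

definition feasible_seq :: "nat list \<Rightarrow> bool list \<Rightarrow> bool" where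
  "feasible_seq ws xs \<longleftrightarrow>
     (\<forall>t \<le> length ws.
        (\<Sum>k<t. cons1 (ws ! k) * ind (xs ! k)) \<le> real t \<and>
        (\<Sum>k<t. cons2 (ws ! k) * ind (xs ! k)) \<le> real t)"

definition reward :: "nat list \<Rightarrow> bool list \<Rightarrow> real" where
  "reward ws xs = (\<Sum>k<length ws. rew (ws ! k) * ind (xs ! k))"

definition hindsight :: "nat list \<Rightarrow> real" where
  "hindsight ws = Max {reward ws xs | xs. length xs = length ws \<and> feasible_seq ws xs}"

text \<open>A (randomized) online policy is given in behavioural form:
 p (orders of periods 1..t) (decisions of periods 1..t-1) is the probability
 of accepting the order in period t.  (Any randomized non-anticipating policy
 induces such a behavioural description with the same joint law of orders and
 decisions.)  path_prob is the joint probability of orders ws and decisions xs.\<close>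
definition path_prob :: "(nat list \<Rightarrow> bool list \<Rightarrow> real) \<Rightarrow> nat list \<Rightarrow> bool list \<Rightarrow> real" where
  "path_prob p ws xs =
     (\<Prod>k<length ws. mu (ws ! k) *
        (if xs ! k then p (take (Suc k) ws) (take k xs) else 1 - p (take (Suc k) ws) (take k xs)))"

definition order_seqs :: "nat \<Rightarrow> nat list set" where
  "order_seqs T = {ws. set ws \<subseteq> types \<and> length ws = T}"

definition dec_seqs :: "nat \<Rightarrow> bool list set" where
  "dec_seqs T = {xs. set xs \<subseteq> UNIV \<and> length xs = T}"

definition feasible_policy :: "nat \<Rightarrow> (nat list \<Rightarrow> bool list \<Rightarrow> real) \<Rightarrow> bool" where
  "feasible_policy T p \<longleftrightarrow>
     (\<forall>ws xs. 0 \<le> p ws xs \<and> p ws xs \<le> 1) \<and>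
     (\<forall>ws \<in> order_seqs T. \<forall>xs \<in> dec_seqs T. path_prob p ws xs > 0 \<longrightarrow> feasible_seq ws xs)"

definition regret :: "nat \<Rightarrow> (nat list \<Rightarrow> bool list \<Rightarrow> real) \<Rightarrow> real" where
  "regret T p = (\<Sum>ws \<in> order_seqs T. \<Sum>xs \<in> dec_seqs T.
                    path_prob p ws xs * (hindsight ws - reward ws xs))"

end

theory Submission
  imports Defs
begin

text \<open>The walks of cumulative supply minus demand of the two resources are independent simple
  symmetric random walks. With probability bounded away from \<open>0\<close>, in a first part of the horizon
  resource 1 drops by an amount of order \<open>sqrt T\<close> while resource 2 does not move much, so every
  feasible policy must have rejected about that many units of resource 1 demand. In the rest of the
  horizon, two continuations both have probability bounded away from \<open>0\<close>. If resource 2 drops as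
  well, it was right to reject orders using both resources; if resource 2 stays level, it was right
  to reject orders using only resource 1. In each case the hindsight optimum has an almost optimal
  feasible solution which makes all these rejections of the right kind at the very start, whereas
  the policy had to choose without knowing the continuation, so in one of them it loses an amount
  of order \<open>sqrt T\<close>. All walks are controlled up to a tube whose width is a small
  multiple of \<open>sqrt T\<close>; a buffer built by rejecting everything initially absorbs these errors.\<close>

section \<open>Expectations over finite i.i.d. sequences\<close>

locale finite_law =
  fixes A :: "'a set" and w :: "'a \<Rightarrow> real"
  assumes finite_support: "finite A"
    and weight_nonneg: "a \<in> A \<Longrightarrow> 0 \<le> w a"
    and weight_sum: "(\<Sum>a\<in>A. w a) = 1"
begin

text \<open>Recursion on the first letter turns estimates for walks into one-step analysis;
  \<open>expect_eq_sum\<close> recovers the sum over all words with product weights.\<close>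

primrec expect :: "nat \<Rightarrow> ('a list \<Rightarrow> real) \<Rightarrow> real" where
  "expect 0 f = f []"
| "expect (Suc n) f = (\<Sum>a\<in>A. w a * expect n (\<lambda>s. f (a # s)))"

lemma expect_mono:
  assumes "\<And>s. set s \<subseteq> A \<Longrightarrow> length s = n \<Longrightarrow> f s \<le> g s"
  shows "expect n f \<le> expect n g"
  using assms
proof (induction n arbitrary: f g)
  case (Suc n)
  show ?case unfolding expect.simps
    by (intro sum_mono mult_left_mono weight_nonneg Suc.IH Suc.prems) auto
qed simp

lemma expect_cong:
  assumes "\<And>s. set s \<subseteq> A \<Longrightarrow> length s = n \<Longrightarrow> f s = g s"
  shows "expect n f = expect n g"
  by (intro antisym expect_mono) (simp_all add: assms)

lemma expect_const [simp]: "expect n (\<lambda>_. c) = c"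
  by (induction n) (simp_all add: weight_sum flip: sum_distrib_right)

lemma expect_add: "expect n (\<lambda>s. f s + g s) = expect n f + expect n g"
  by (induction n arbitrary: f g) (simp_all add: distrib_left sum.distrib)

lemma expect_cmult: "expect n (\<lambda>s. c * f s) = c * expect n f"
  by (induction n arbitrary: f) (simp_all add: sum_distrib_left mult.left_commute)

lemma expect_nonneg:
  assumes "\<And>s. set s \<subseteq> A \<Longrightarrow> length s = n \<Longrightarrow> 0 \<le> f s"
  shows "0 \<le> expect n f"
  using expect_mono[of n "\<lambda>_. 0" f] assms by simp

lemma expect_append:
  "expect (m + n) f = expect m (\<lambda>u. expect n (\<lambda>v. f (u @ v)))"
  by (induction m arbitrary: f) simp_all

lemma expect_eq_sum:
  "expect n f = (\<Sum>s | set s \<subseteq> A \<and> length s = n. (\<Prod>k<n. w (s ! k)) * f s)"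
proof (induction n arbitrary: f)
  case 0
  have "{s. set s \<subseteq> A \<and> length s = 0} = {[]}" by auto
  then show ?case by (simp del: length_0_conv)
next
  case (Suc n)
  let ?L = "{s. set s \<subseteq> A \<and> length s = n}"
  have eq: "{s. set s \<subseteq> A \<and> length s = Suc n} = (\<lambda>(a, s). a # s) ` (A \<times> ?L)"
    by (auto simp: length_Suc_conv image_iff)
  have inj: "inj_on (\<lambda>(a, s). a # s) (A \<times> ?L)" by (auto simp: inj_on_def)
  show ?case unfolding eq
    by (subst sum.reindex[OF inj])
      (simp add: Suc.IH case_prod_unfold prod.lessThan_Suc_shift sum.cartesian_product
        sum_distrib_left mult.assoc del: prod.lessThan_Suc)
qed

end

section \<open>Walks confined to a set\<close>

primrec stays :: "real set \<Rightarrow> real \<Rightarrow> real list \<Rightarrow> bool" where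
  "stays I x [] = (x \<in> I)"
| "stays I x (a # s) = (x \<in> I \<and> stays I (x + a) s)"

lemma stays_start: "stays I x s \<Longrightarrow> x \<in> I"
  by (cases s) auto

lemma stays_end: "stays I x s \<Longrightarrow> x + sum_list s \<in> I"
  by (induction s arbitrary: x) (auto simp flip: add.assoc)

lemma stays_append:
  "stays I x (s @ s') \<longleftrightarrow> stays I x s \<and> stays I (x + sum_list s) s'"
  by (induction s arbitrary: x) (auto simp: add.assoc dest: stays_start)

lemma stays_shift:
  assumes "stays I x s" and "\<And>z. z \<in> I \<Longrightarrow> z + d \<in> J" and "y = x + d"
  shows "stays J y s"
  using assms(1,3)
proof (induction s arbitrary: x y)
  case (Cons a s)
  then show ?case using assms(2) Cons.IH[of "x + a" "y + a"] by auto
qed (use assms(2) in auto)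

lemma stays_Int: "stays (I \<inter> J) x s \<longleftrightarrow> stays I x s \<and> stays J x s"
  by (induction s arbitrary: x) auto

lemma stays_uminus: "stays I x (map uminus s) \<longleftrightarrow> stays (uminus ` I) (- x) s"
proof (induction s arbitrary: x)
  case (Cons a s)
  show ?case using Cons[of "x - a"] by (auto simp: image_iff)
qed (auto simp: image_iff)

lemma stays_map_mono:
  assumes "stays {l..} x (map f s)" and "x \<le> y" and "\<And>a. a \<in> set s \<Longrightarrow> f a \<le> g a"
  shows "stays {l..} y (map g s)"
  using assms
proof (induction s arbitrary: x y)
  case (Cons a s)
  have "stays {l..} (y + g a) (map g s)"
    by (rule Cons.IH[of "x + f a"]) (use Cons.prems(1,2) Cons.prems(3)[of a] in \<open>auto intro: Cons.prems(3)\<close>)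
  with Cons.prems show ?case by auto
qed auto

lemma stays_iff_prefix_sums:
  "stays I x s \<longleftrightarrow> (\<forall>t\<le>length s. x + (\<Sum>k<t. s ! k) \<in> I)"
proof (induction s arbitrary: x)
  case (Cons a s)
  have "(\<forall>t\<le>length (a # s). x + (\<Sum>k<t. (a # s) ! k) \<in> I) \<longleftrightarrow>
      x \<in> I \<and> (\<forall>t\<le>length s. x + (\<Sum>k<Suc t. (a # s) ! k) \<in> I)"
    by (subst All_less_Suc2[of "length (a # s)", unfolded less_Suc_eq_le]) (simp add: less_Suc_eq_le)
  then show ?case
    by (simp add: Cons sum.lessThan_Suc_shift add.assoc del: sum.lessThan_Suc)
qed simp

text \<open>Kolmogorov's maximal inequality. The mean square of the position grows by at most
  \<open>1\<close> per step, which \<open>real n\<close> pays for; once the walk is outside, the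
  bound is already at least \<open>1\<close>.\<close>

lemma (in finite_law) maximal_inequality:
  fixes z :: "'a \<Rightarrow> real"
  assumes mean: "(\<Sum>a\<in>A. w a * z a) = 0" and var: "(\<Sum>a\<in>A. w a * (z a)\<^sup>2) \<le> 1"
    and l: "0 < l"
  shows "expect n (\<lambda>s. of_bool (\<not> stays {-l..l} x (map z s))) \<le> (x\<^sup>2 + real n) / l\<^sup>2"
proof (induction n arbitrary: x)
  case 0
  have "\<not> stays {-l..l} x [] \<Longrightarrow> l\<^sup>2 \<le> x\<^sup>2"
    using l by (auto intro!: power2_le_iff_abs_le[THEN iffD2] simp: abs_le_square_iff[symmetric])
  then show ?case using l by (auto simp: field_simps)
next
  case (Suc n)
  show ?case
  proof (cases "x \<in> {-l..l}")
    case True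
    have "expect (Suc n) (\<lambda>s. of_bool (\<not> stays {-l..l} x (map z s)))
        \<le> (\<Sum>a\<in>A. w a * (((x + z a)\<^sup>2 + real n) / l\<^sup>2))"
      using True by (auto intro!: sum_mono mult_left_mono weight_nonneg Suc.IH simp del: times_divide_eq_right)
    also have "\<dots> = ((\<Sum>a\<in>A. w a) * (x\<^sup>2 + real n) + 2 * x * (\<Sum>a\<in>A. w a * z a)
        + (\<Sum>a\<in>A. w a * (z a)\<^sup>2)) / l\<^sup>2"
      by (simp add: sum_distrib_left sum_distrib_right sum_divide_distrib power2_sum
          flip: sum.distrib) (intro sum.cong; simp add: field_simps)
    also have "\<dots> \<le> (x\<^sup>2 + real (Suc n)) / l\<^sup>2"
      using mean var by (intro divide_right_mono) (auto simp: weight_sum)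
    finally show ?thesis .
  next
    case False
    then have "l\<^sup>2 \<le> x\<^sup>2" using l by (auto simp: abs_le_square_iff[symmetric])
    then have "1 \<le> (x\<^sup>2 + real (Suc n)) / l\<^sup>2" using l by (simp add: field_simps)
    moreover have "expect (Suc n) (\<lambda>s. of_bool (\<not> stays {-l..l} x (map z s))) \<le> expect (Suc n) (\<lambda>_. 1)"
      by (intro expect_mono) auto
    ultimately show ?thesis unfolding expect_const by linarith
  qed
qed

section \<open>The simple symmetric walk\<close>

interpretation coin: finite_law "{1, -1 :: real}" "\<lambda>_. 1/2"
  by unfold_locales auto

lemma coin_step:
  "coin.expect (Suc n) f = (coin.expect n (\<lambda>s. f (1 # s)) + coin.expect n (\<lambda>s. f (-1 # s))) / 2"
  by (simp add: field_simps)

declare coin.expect.simps(2) [simp del]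

lemma coin_symmetric: "coin.expect n (\<lambda>s. f (map uminus s)) = coin.expect n f"
proof (induction n arbitrary: f)
  case (Suc n)
  show ?case using Suc[of "\<lambda>s. f (1 # s)"] Suc[of "\<lambda>s. f (-1 # s)"] by (simp add: coin_step)
qed simp

text \<open>On the interval, \<open>cos (\<theta> x)\<close> is an eigenfunction of the step operator with eigenvalue
  \<open>cos \<theta>\<close>, and outside, as far as one step can reach, it is nonpositive.\<close>

lemma tube_ge_cos:
  assumes b: "1 \<le> b" and \<theta>: "\<theta> = pi / (2 * b)" and x: "\<bar>x\<bar> \<le> b + 1"
  shows "cos \<theta> ^ n * cos (\<theta> * x) \<le> coin.expect n (\<lambda>s. of_bool (stays {-b..b} x s))"
proof -
  have outside: "cos (\<theta> * y) \<le> 0" if "b < \<bar>y\<bar>" "\<bar>y\<bar> \<le> b + 1" for y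
  proof -
    have "pi / 2 \<le> \<theta> * \<bar>y\<bar>" using that b unfolding \<theta> by (simp add: field_simps)
    moreover have "\<theta> * \<bar>y\<bar> \<le> pi"
    proof -
      have "\<theta> * \<bar>y\<bar> \<le> \<theta> * (2 * b)" using that b \<theta> by (intro mult_left_mono) auto
      then show ?thesis using b \<theta> by simp
    qed
    ultimately have "cos (\<theta> * \<bar>y\<bar>) \<le> cos (pi / 2)" by (intro cos_monotone_0_pi_le) auto
    moreover have "cos (\<theta> * \<bar>y\<bar>) = cos (\<theta> * y)" by (cases "0 \<le> y") auto
    ultimately show ?thesis by simp
  qed
  show ?thesis using x
  proof (induction n arbitrary: x)
    case 0
    then show ?case using outside[of x] by (auto simp: abs_le_iff)
  next
    case (Suc n)
    show ?case
    proof (cases "\<bar>x\<bar> \<le> b")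
      case True
      have "cos \<theta> ^ Suc n * cos (\<theta> * x)
          = (cos \<theta> ^ n * cos (\<theta> * (x + 1)) + cos \<theta> ^ n * cos (\<theta> * (x - 1))) / 2"
        by (simp add: distrib_left right_diff_distrib cos_add cos_diff algebra_simps)
      also have "\<dots> \<le> (coin.expect n (\<lambda>s. of_bool (stays {-b..b} (x + 1) s))
          + coin.expect n (\<lambda>s. of_bool (stays {-b..b} (x - 1) s))) / 2"
        using True by (intro divide_right_mono add_mono Suc.IH) auto
      finally show ?thesis using True by (simp add: coin_step abs_le_iff)
    next
      case False
      have "\<theta> * 1 \<le> \<theta> * b" using b \<theta> by (intro mult_left_mono) auto
      then have "0 \<le> cos \<theta>" using b \<theta> by (intro cos_ge_zero) (auto intro: order_trans[of _ 0])
      then have "cos \<theta> ^ Suc n * cos (\<theta> * x) \<le> 0"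
        using outside[OF _ Suc.prems] False by (intro mult_nonneg_nonpos) auto
      with False show ?thesis by (auto simp: coin_step abs_le_iff)
    qed
  qed
qed

text \<open>At \<open>x = 0\<close> the cosine bound is a power of the eigenvalue
  \<open>cos \<theta>\<close>, which is at least \<open>1 - \<theta>\<^sup>2 / 2\<close>;
  \<open>pi < 4\<close> makes this at least \<open>exp (- (4 / b\<^sup>2))\<close>.\<close>

lemma tube_ge:
  assumes b: "2 \<le> b"
  shows "exp (- 4 * real n / b\<^sup>2) \<le> coin.expect n (\<lambda>s. of_bool (stays {-b..b} 0 s))"
proof -
  define \<theta> where "\<theta> = pi / (2 * b)"
  have th: "\<theta>\<^sup>2 \<le> 4 / b\<^sup>2"
  proof -
    have "\<theta> \<le> 2 / b" using pi_less_4 b by (simp add: \<theta>_def field_simps)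
    then have "\<theta>\<^sup>2 \<le> (2 / b)\<^sup>2" using b by (intro power_mono) (auto simp: \<theta>_def)
    then show ?thesis by (simp add: power_divide)
  qed
  have "4 \<le> b\<^sup>2" using power_mono[OF b, of 2] by simp
  then have "4 / b\<^sup>2 \<le> 1" by (intro divide_le_eq_1_pos[THEN iffD2]) auto
  with th have half: "\<theta>\<^sup>2 / 2 \<le> 1 / 2" by simp
  have "- (4 / b\<^sup>2) \<le> - (\<theta>\<^sup>2 / 2) - 2 * (\<theta>\<^sup>2 / 2)\<^sup>2"
  proof -
    have "2 * (\<theta>\<^sup>2 / 2)\<^sup>2 \<le> \<theta>\<^sup>2 / 2"
      using mult_left_mono[OF half, of "\<theta>\<^sup>2"] by (simp add: power2_eq_square)
    with th show ?thesis by simp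
  qed
  also have "\<dots> \<le> ln (1 - \<theta>\<^sup>2 / 2)"
    using half by (intro ln_one_minus_pos_lower_bound) auto
  finally have "exp (- (4 / b\<^sup>2)) \<le> 1 - \<theta>\<^sup>2 / 2"
    using half by (simp add: ln_ge_iff)
  also have "\<dots> \<le> cos \<theta>"
  proof -
    have "(sin (\<theta> / 2))\<^sup>2 \<le> (\<theta> / 2)\<^sup>2"
      using abs_sin_x_le_abs_x[of "\<theta> / 2"] by (simp only: abs_le_square_iff)
    then show ?thesis using cos_double_sin[of "\<theta> / 2"] by (simp add: power_divide)
  qed
  finally have "exp (- (4 / b\<^sup>2)) \<le> cos \<theta>" .
  then have "exp (- (4 / b\<^sup>2)) ^ n \<le> cos \<theta> ^ n" by (intro power_mono) auto
  also have "\<dots> \<le> coin.expect n (\<lambda>s. of_bool (stays {-b..b} 0 s))"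
    using tube_ge_cos[OF _ \<theta>_def, of 0 n] b by simp
  finally show ?thesis by (simp add: exp_of_nat_mult[symmetric] mult.commute)
qed

text \<open>Markov's inequality for the exit time: inside the interval,
  \<open>(D + 1)\<^sup>2 - x\<^sup>2\<close> exceeds the mean of its values at the two neighbours by
  exactly \<open>1\<close>. The \<open>D + 1\<close> allows for the overshoot of the last
  step.\<close>

lemma exit_time_bound:
  assumes "\<bar>x\<bar> \<le> D + 1"
  shows "real n * coin.expect n (\<lambda>s. of_bool (stays {-D<..<D} x s)) \<le> (D + 1)\<^sup>2 - x\<^sup>2"
  using assms
proof (induction n arbitrary: x)
  case 0
  then show ?case by (simp add: abs_le_square_iff[symmetric])
next
  case (Suc n)
  show ?case
  proof (cases "x \<in> {-D<..<D}")
    case True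
    let ?Q = "\<lambda>y. coin.expect n (\<lambda>s. of_bool (stays {-D<..<D} y s))"
    have le1: "?Q y \<le> 1" for y
      using coin.expect_mono[of n "\<lambda>s. of_bool (stays {-D<..<D} y s)" "\<lambda>_. 1"] by simp
    have "real n * ?Q (x + 1) \<le> (D + 1)\<^sup>2 - (x + 1)\<^sup>2" "real n * ?Q (x - 1) \<le> (D + 1)\<^sup>2 - (x - 1)\<^sup>2"
      using True by (auto intro!: Suc.IH)
    moreover have "(D + 1)\<^sup>2 - x\<^sup>2 = (((D + 1)\<^sup>2 - (x + 1)\<^sup>2) + ((D + 1)\<^sup>2 - (x - 1)\<^sup>2)) / 2 + 1"
      by (simp add: power2_eq_square field_simps)
    moreover have "coin.expect (Suc n) (\<lambda>s. of_bool (stays {-D<..<D} x s)) = (?Q (x + 1) + ?Q (x - 1)) / 2"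
      using True by (simp add: coin_step)
    then have eq: "real (Suc n) * coin.expect (Suc n) (\<lambda>s. of_bool (stays {-D<..<D} x s))
        = (real n * ?Q (x + 1) + real n * ?Q (x - 1)) / 2 + (?Q (x + 1) + ?Q (x - 1)) / 2"
      by (simp only: of_nat_Suc) (simp add: algebra_simps add_divide_distrib)
    ultimately show ?thesis unfolding eq using le1[of "x + 1"] le1[of "x - 1"] by argo
  next
    case False
    then have "coin.expect (Suc n) (\<lambda>s. of_bool (stays {-D<..<D} x s)) = coin.expect (Suc n) (\<lambda>_. 0)"
      by (intro coin.expect_cong) (auto dest: stays_start)
    with Suc.prems show ?thesis by (simp add: abs_le_square_iff[symmetric])
  qed
qed

text \<open>The walk is unlikely to stay strictly within distance \<open>D\<close> of its start, and
  by symmetry reaching distance \<open>D\<close> above is as likely as below; hence the factor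
  \<open>1/2\<close>.\<close>

lemma hit_ge:
  assumes D: "0 \<le> D" and n: "0 < n"
  shows "(1 - (D + 1)\<^sup>2 / real n) / 2 \<le> coin.expect n (\<lambda>s. of_bool (\<not> stays {0<..} D s))"
proof -
  have shift: "stays {0<..} D s \<longleftrightarrow> stays {-D<..} 0 s" for s
    using stays_shift[of "{0<..}" D s "-D" "{-D<..}" 0] stays_shift[of "{-D<..}" 0 s D "{0<..}" D]
    by auto
  have neg: "stays {..<D} 0 s \<longleftrightarrow> stays {-D<..} 0 (map uminus s)" for s
    by (simp add: stays_uminus)
  have split: "{-D<..<D} = {-D<..} \<inter> {..<D}" by auto
  let ?P = "coin.expect n (\<lambda>s. of_bool (\<not> stays {-D<..} 0 s))"
  have "1 = coin.expect n (\<lambda>_. 1)" by simp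
  also have "\<dots> \<le> coin.expect n (\<lambda>s. of_bool (stays {-D<..<D} 0 s) + (of_bool (\<not> stays {-D<..} 0 s)
      + of_bool (\<not> stays {-D<..} 0 (map uminus s))))"
    by (intro coin.expect_mono) (auto simp: split stays_Int neg)
  also have "\<dots> = coin.expect n (\<lambda>s. of_bool (stays {-D<..<D} 0 s)) + (?P + ?P)"
    by (simp only: coin.expect_add coin_symmetric[of n "\<lambda>s. of_bool (\<not> stays {-D<..} 0 s)"])
  finally have "1 \<le> coin.expect n (\<lambda>s. of_bool (stays {-D<..<D} 0 s)) + 2 * ?P" by simp
  moreover have "coin.expect n (\<lambda>s. of_bool (stays {-D<..<D} 0 s)) \<le> (D + 1)\<^sup>2 / real n"
    using exit_time_bound[of 0 D n] D n by (simp add: field_simps)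
  ultimately show ?thesis by (simp add: shift)
qed

text \<open>Once the walk has hit \<open>0\<close>, it only has to remain in the tube.\<close>

lemma hit_then_tube:
  fixes x :: int
  assumes b: "2 \<le> b" and "0 \<le> x" and "n \<le> N"
  shows "exp (- 4 * real N / b\<^sup>2) * coin.expect n (\<lambda>s. of_bool (\<not> stays {0<..} x s))
    \<le> coin.expect n (\<lambda>s. of_bool (stays {-b..} x s \<and> x + sum_list s \<le> b))"
  using assms(2,3)
proof (induction n arbitrary: x)
  case 0
  then show ?case using b by (auto intro!: order_trans[OF _ b])
next
  case (Suc n)
  show ?case
  proof (cases "x = 0")
    case True
    have "{- b..b} = {-b..} \<inter> {..b}" by auto
    then have "stays {-b..b} 0 s \<Longrightarrow> stays {-b..} 0 s \<and> sum_list s \<le> b" for s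
      using stays_end[of "{-b..b}" 0 s] by (auto simp: stays_Int)
    then have "coin.expect (Suc n) (\<lambda>s. of_bool (stays {-b..b} 0 s))
        \<le> coin.expect (Suc n) (\<lambda>s. of_bool (stays {-b..} x s \<and> x + sum_list s \<le> b))"
      using True by (intro coin.expect_mono) auto
    moreover have "exp (- 4 * real N / b\<^sup>2) \<le> exp (- 4 * real (Suc n) / b\<^sup>2)"
      unfolding exp_le_cancel_iff using Suc.prems b by (intro divide_right_mono) auto
    moreover have "exp (- 4 * real N / b\<^sup>2) * coin.expect (Suc n) (\<lambda>s. of_bool (\<not> stays {0<..} x s))
        \<le> exp (- 4 * real N / b\<^sup>2) * coin.expect (Suc n) (\<lambda>s. 1)"
      by (intro mult_left_mono coin.expect_mono) auto
    ultimately show ?thesis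
      using tube_ge[OF b, of "Suc n"] unfolding coin.expect_const by linarith
  next
    case False
    with Suc.prems have x: "1 \<le> x" by simp
    have "exp (- 4 * real N / b\<^sup>2) * coin.expect n (\<lambda>s. of_bool (\<not> stays {0<..} (x + 1) s))
      \<le> coin.expect n (\<lambda>s. of_bool (stays {-b..} (x + 1) s \<and> (x + 1) + sum_list s \<le> b))"
      "exp (- 4 * real N / b\<^sup>2) * coin.expect n (\<lambda>s. of_bool (\<not> stays {0<..} (x - 1) s))
      \<le> coin.expect n (\<lambda>s. of_bool (stays {-b..} (x - 1) s \<and> (x - 1) + sum_list s \<le> b))"
      using Suc.IH[of "x + 1"] Suc.IH[of "x - 1"] Suc.prems x by simp_all
    then show ?thesis using x b by (simp add: coin_step algebra_simps)
  qed
qed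

text \<open>First reach \<open>- D\<close>, then stay within \<open>b\<close> of it;
  \<open>D\<close> is a natural number so that the level is hit exactly.\<close>

lemma drop_ge:
  assumes b: "2 \<le> b" and n: "0 < n"
  shows "exp (- 4 * real n / b\<^sup>2) * ((1 - (real D + 1)\<^sup>2 / real n) / 2)
    \<le> coin.expect n (\<lambda>s. of_bool (stays {-(D + b)..} 0 s \<and> sum_list s \<le> b - D))"
proof -
  have shift: "stays {-b..} D s \<longleftrightarrow> stays {-(D + b)..} 0 s" for s
    using stays_shift[of "{-b..}" D s "-D" "{-(D + b)..}" 0] stays_shift[of "{-(D + b)..}" 0 s D "{-b..}" D]
    by auto
  have "exp (- 4 * real n / b\<^sup>2) * ((1 - (real D + 1)\<^sup>2 / real n) / 2)
      \<le> exp (- 4 * real n / b\<^sup>2) * coin.expect n (\<lambda>s. of_bool (\<not> stays {0<..} D s))"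
    using n by (intro mult_left_mono hit_ge) auto
  also have "\<dots> \<le> coin.expect n (\<lambda>s. of_bool (stays {-b..} D s \<and> D + sum_list s \<le> b))"
    using hit_then_tube[OF b, of "int D" n n] by simp
  finally show ?thesis by (simp add: shift algebra_simps)
qed


section \<open>Orders and policies\<close>

definition net1 :: "nat \<Rightarrow> real" where "net1 i = 1 - cons1 i"
definition net2 :: "nat \<Rightarrow> real" where "net2 i = 1 - cons2 i"

lemma order_values [simp]:
  "mu 0 = 1/4" "mu (Suc 0) = 1/8" "mu 2 = 1/8" "mu 3 = 1/8" "mu 4 = 1/8" "mu 5 = 1/4"
  "rew 0 = 5" "rew (Suc 0) = 3" "rew 2 = 3" "rew 3 = 4" "rew 4 = 4" "rew 5 = 0"
  "cons1 0 = 2" "cons1 (Suc 0) = 2" "cons1 2 = 0" "cons1 3 = 2" "cons1 4 = 0" "cons1 5 = 0"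
  "cons2 0 = 2" "cons2 (Suc 0) = 0" "cons2 2 = 2" "cons2 3 = 0" "cons2 4 = 2" "cons2 5 = 0"
  by (simp_all add: mu_def rew_def cons1_def cons2_def)

lemma net_values [simp]:
  "net1 0 = -1" "net1 (Suc 0) = -1" "net1 2 = 1" "net1 3 = -1" "net1 4 = 1" "net1 5 = 1"
  "net2 0 = -1" "net2 (Suc 0) = 1" "net2 2 = -1" "net2 3 = 1" "net2 4 = -1" "net2 5 = 1"
  by (simp_all add: net1_def net2_def)

lemma types_eq: "types = {0, 1, 2, 3, 4, 5}"
  by (auto simp: types_def)

lemma sum_types: "(\<Sum>i\<in>types. f i) = f 0 + f 1 + f 2 + f 3 + f 4 + (f 5 :: real)"
  by (simp add: types_eq)

lemma mu_pos: "i \<in> types \<Longrightarrow> 0 < mu i"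
  by (auto simp: types_eq)

interpretation orders: finite_law types mu
  by unfold_locales (auto simp: sum_types types_eq)

text \<open>Each of the four sign patterns of \<open>net1\<close> and \<open>net2\<close> has total
  weight \<open>1/4\<close>, as for two independent fair coins.\<close>

lemma net_walks_independent:
  "orders.expect n (\<lambda>ws. f (map net1 ws) * g (map net2 ws)) = coin.expect n f * coin.expect n g"
proof (induction n arbitrary: f g)
  case (Suc n)
  show ?case
    using Suc[of "\<lambda>s. f (1 # s)" "\<lambda>s. g (1 # s)"] Suc[of "\<lambda>s. f (1 # s)" "\<lambda>s. g (-1 # s)"]
      Suc[of "\<lambda>s. f (-1 # s)" "\<lambda>s. g (1 # s)"] Suc[of "\<lambda>s. f (-1 # s)" "\<lambda>s. g (-1 # s)"]
    by (simp add: sum_types coin_step field_simps)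
qed simp

text \<open>The law of the decisions given the orders, split off so that the orders can be averaged
  block by block.\<close>

definition decision_prob :: "(nat list \<Rightarrow> bool list \<Rightarrow> real) \<Rightarrow> nat list \<Rightarrow> bool list \<Rightarrow> real" where
  "decision_prob p ws xs = (\<Prod>k<length ws.
     if xs ! k then p (take (Suc k) ws) (take k xs) else 1 - p (take (Suc k) ws) (take k xs))"

lemma path_prob_eq: "path_prob p ws xs = (\<Prod>k<length ws. mu (ws ! k)) * decision_prob p ws xs"
  by (simp add: path_prob_def decision_prob_def prod.distrib)

lemma decision_prob_nonneg:
  assumes "\<And>ws xs. 0 \<le> p ws xs \<and> p ws xs \<le> 1"
  shows "0 \<le> decision_prob p ws xs"
  unfolding decision_prob_def using assms by (intro prod_nonneg) auto

lemma decision_prob_snoc: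
  assumes "length xs = length ws"
  shows "decision_prob p (ws @ [i]) (xs @ [x])
    = decision_prob p ws xs * (if x then p (ws @ [i]) xs else 1 - p (ws @ [i]) xs)"
proof -
  have "decision_prob p ws xs = (\<Prod>k<length ws.
     if (xs @ [x]) ! k then p (take (Suc k) (ws @ [i])) (take k (xs @ [x]))
     else 1 - p (take (Suc k) (ws @ [i])) (take k (xs @ [x])))"
    unfolding decision_prob_def using assms by (intro prod.cong) (auto simp: nth_append)
  then show ?thesis using assms by (simp add: decision_prob_def nth_append)
qed

lemma sum_dec_seqs_Suc:
  "(\<Sum>xs\<in>dec_seqs (Suc n). f xs) = (\<Sum>xs\<in>dec_seqs n. f (xs @ [True]) + f (xs @ [False]) :: real)"
proof -
  have eq: "dec_seqs (Suc n) = (\<lambda>(xs, x). xs @ [x]) ` (dec_seqs n \<times> UNIV)"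
    by (auto simp: dec_seqs_def length_Suc_conv_rev image_iff)
  have inj: "inj_on (\<lambda>(xs, x). xs @ [x]) (dec_seqs n \<times> UNIV)" by (auto simp: inj_on_def)
  have "(\<Sum>xs\<in>dec_seqs (Suc n). f xs) = (\<Sum>(xs, x)\<in>dec_seqs n \<times> UNIV. f (xs @ [x]))"
    unfolding eq by (subst sum.reindex[OF inj]) (simp add: case_prod_unfold)
  also have "\<dots> = (\<Sum>xs\<in>dec_seqs n. \<Sum>x\<in>UNIV. f (xs @ [x]))"
    by (simp only: sum.cartesian_product)
  finally show ?thesis by (simp add: UNIV_bool add.commute)
qed

text \<open>Non-anticipation: the law of the first decisions does not depend on later orders. Later
  decisions are summed out one by one, since accepting and rejecting have total probability
  \<open>1\<close>.\<close>

lemma decision_prob_marginal: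
  "(\<Sum>xs\<in>dec_seqs (length u + length v). decision_prob p (u @ v) xs * g (take (length u) xs))
    = (\<Sum>xs\<in>dec_seqs (length u). decision_prob p u xs * g xs)"
proof (induction v rule: rev_induct)
  case Nil
  show ?case by (intro sum.cong) (auto simp: dec_seqs_def)
next
  case (snoc i v)
  have "(\<Sum>xs\<in>dec_seqs (length u + length (v @ [i])).
        decision_prob p (u @ v @ [i]) xs * g (take (length u) xs))
      = (\<Sum>xs\<in>dec_seqs (length u + length v). decision_prob p (u @ v) xs * g (take (length u) xs))"
    unfolding length_append list.size add_Suc_right add_0_right One_nat_def sum_dec_seqs_Suc
  proof (rule sum.cong)
    fix xs :: "bool list" assume "xs \<in> dec_seqs (length u + length v)"
    then have len: "length xs = length (u @ v)" by (simp add: dec_seqs_def)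
    have "decision_prob p (u @ v @ [i]) (xs @ [True]) + decision_prob p (u @ v @ [i]) (xs @ [False])
        = decision_prob p (u @ v) xs"
      using decision_prob_snoc[OF len, of p i True] decision_prob_snoc[OF len, of p i False]
      by (simp add: algebra_simps)
    then show "decision_prob p (u @ v @ [i]) (xs @ [True]) * g (take (length u) (xs @ [True])) +
        decision_prob p (u @ v @ [i]) (xs @ [False]) * g (take (length u) (xs @ [False])) =
        decision_prob p (u @ v) xs * g (take (length u) xs)"
      using len by (simp flip: distrib_right)
  qed simp
  with snoc show ?case by simp
qed

lemma decision_prob_sum: "(\<Sum>xs\<in>dec_seqs (length ws). decision_prob p ws xs) = 1"
  using decision_prob_marginal[where u = "[]" and v = ws and p = p and g = "\<lambda>_. 1"]
  by (simp add: dec_seqs_def decision_prob_def)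

definition expected_gap :: "(nat list \<Rightarrow> bool list \<Rightarrow> real) \<Rightarrow> nat list \<Rightarrow> real" where
  "expected_gap p ws =
    (\<Sum>xs\<in>dec_seqs (length ws). decision_prob p ws xs * (hindsight ws - reward ws xs))"

lemma regret_eq_expect: "regret T p = orders.expect T (expected_gap p)"
  unfolding regret_def orders.expect_eq_sum expected_gap_def order_seqs_def
  by (intro sum.cong) (auto simp: path_prob_eq sum_distrib_left mult.assoc)

lemma hindsight_upper:
  assumes "length xs = length ws" and "feasible_seq ws xs"
  shows "reward ws xs \<le> hindsight ws"
proof -
  have "finite {xs :: bool list. set xs \<subseteq> UNIV \<and> length xs = length ws}"
    by (intro finite_lists_length_eq) simp
  then have "finite (reward ws ` {xs. length xs = length ws \<and> feasible_seq ws xs})"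
    by (intro finite_imageI) (rule finite_subset[rotated], auto)
  then show ?thesis unfolding hindsight_def
    using assms by (intro Max_ge) (auto simp: image_def setcompr_eq_image)
qed

text \<open>Orders carry positive probability, so a policy is feasible on every decision path that it
  follows with positive probability.\<close>

lemma expected_gap_ge:
  assumes p: "feasible_policy T p" and ws: "set ws \<subseteq> types" "length ws = T"
    and gap: "\<And>xs. length xs = T \<Longrightarrow> feasible_seq ws xs \<Longrightarrow> h xs \<le> hindsight ws - reward ws xs"
  shows "(\<Sum>xs\<in>dec_seqs T. decision_prob p ws xs * h xs) \<le> expected_gap p ws"
  unfolding expected_gap_def ws(2)
proof (rule sum_mono)
  fix xs assume xs: "xs \<in> dec_seqs T"
  have nonneg: "0 \<le> decision_prob p ws xs"
    using p by (intro decision_prob_nonneg) (auto simp: feasible_policy_def)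
  show "decision_prob p ws xs * h xs \<le> decision_prob p ws xs * (hindsight ws - reward ws xs)"
  proof (cases "decision_prob p ws xs = 0")
    case False
    have "0 < (\<Prod>k<length ws. mu (ws ! k))" using ws by (intro prod_pos) (auto intro!: mu_pos subsetD[OF _ nth_mem])
    with False nonneg have "0 < path_prob p ws xs" by (simp add: path_prob_eq)
    with p ws xs have "feasible_seq ws xs" by (auto simp: feasible_policy_def order_seqs_def)
    with gap xs nonneg show ?thesis by (intro mult_left_mono) (auto simp: dec_seqs_def)
  qed simp
qed

section \<open>Rejections\<close>

definition rejected :: "(nat \<Rightarrow> real) \<Rightarrow> nat list \<Rightarrow> bool list \<Rightarrow> real" where
  "rejected f ws xs = (\<Sum>k<length ws. f (ws ! k) * ind (\<not> xs ! k))"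

lemma rejected_take: "rejected f ws (take (length ws) xs) = rejected f ws xs"
  by (simp add: rejected_def)

lemma rejected_mono:
  assumes "\<And>i. i \<in> set ws \<Longrightarrow> f i \<le> g i"
  shows "rejected f ws xs \<le> rejected g ws xs"
  unfolding rejected_def using assms by (intro sum_mono mult_right_mono) (auto simp: ind_def)

lemma rejected_linear:
  "rejected (\<lambda>i. a * f i + b * g i) ws xs = a * rejected f ws xs + b * rejected g ws xs"
  by (simp add: rejected_def sum.distrib sum_distrib_left distrib_right mult.assoc)

lemma rejected_prefix:
  assumes "\<And>i. i \<in> set v \<Longrightarrow> 0 \<le> f i"
  shows "rejected f u xs \<le> rejected f (u @ v) xs"
proof -
  have "rejected f u xs = (\<Sum>k<length u. f ((u @ v) ! k) * ind (\<not> xs ! k))"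
    by (simp add: rejected_def nth_append)
  also have "\<dots> \<le> rejected f (u @ v) xs" unfolding rejected_def
  proof (rule sum_mono2)
    fix k assume k: "k \<in> {..<length (u @ v)} - {..<length u}"
    then have "(u @ v) ! k \<in> set v" by (auto simp: nth_append)
    then show "0 \<le> f ((u @ v) ! k) * ind (\<not> xs ! k)" using assms by (simp add: ind_def)
  qed auto
  finally show ?thesis .
qed

text \<open>The reward on offer is the same for all decisions, so gaps reduce to comparing rejected
  rewards.\<close>

lemma reward_eq: "reward ws xs = sum_list (map rew ws) - rejected rew ws xs"
  by (simp add: reward_def rejected_def sum_list_sum_nth atLeast0LessThan flip: sum_subtractf)
    (intro sum.cong; simp add: ind_def)

lemma accepted_eq:
  "(\<Sum>k<length u. f ((u @ v) ! k) * ind (xs ! k)) = sum_list (map f u) - rejected f u xs"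
  by (simp add: rejected_def sum_list_sum_nth atLeast0LessThan nth_append flip: sum_subtractf)
    (intro sum.cong; simp add: ind_def)

lemma sum_list_map_net:
  "sum_list (map net1 u) = real (length u) - sum_list (map cons1 u)"
  "sum_list (map net2 u) = real (length u) - sum_list (map cons2 u)"
  by (induction u) (simp_all add: net1_def net2_def)

text \<open>Feasibility at the end of \<open>u\<close> bounds the accepted consumption by
  \<open>length u\<close>; excess demand must have been rejected.\<close>

lemma rejected_ge_deficit:
  assumes "feasible_seq (u @ v) xs"
  shows "- sum_list (map net1 u) \<le> rejected cons1 u xs"
    and "- sum_list (map net2 u) \<le> rejected cons2 u xs"
  using assms[unfolded feasible_seq_def, rule_format, of "length u"]
  by (simp_all add: accepted_eq sum_list_map_net)

section \<open>A feasible solution in hindsight\<close>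

lemma feasible_seq_iff_stays:
  assumes "length xs = length ws"
  shows "feasible_seq ws xs \<longleftrightarrow>
    stays {0..} 0 (map2 (\<lambda>i x. 1 - cons1 i * ind x) ws xs) \<and>
    stays {0..} 0 (map2 (\<lambda>i x. 1 - cons2 i * ind x) ws xs)"
proof -
  have "stays {0..} 0 (map2 (\<lambda>i x. 1 - f i * ind x) ws xs) \<longleftrightarrow>
      (\<forall>t\<le>length ws. (\<Sum>k<t. f (ws ! k) * ind (xs ! k)) \<le> real t)" for f :: "nat \<Rightarrow> real"
  proof -
    have "(\<Sum>k<t. map2 (\<lambda>i x. 1 - f i * ind x) ws xs ! k) = real t - (\<Sum>k<t. f (ws ! k) * ind (xs ! k))"
      if "t \<le> length ws" for t
    proof -
      have "(\<Sum>k<t. map2 (\<lambda>i x. 1 - f i * ind x) ws xs ! k) = (\<Sum>k<t. 1 - f (ws ! k) * ind (xs ! k))"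
        using that assms by (intro sum.cong) auto
      then show ?thesis by (simp add: sum_subtractf)
    qed
    then show ?thesis using assms by (simp add: stays_iff_prefix_sums)
  qed
  then show ?thesis unfolding feasible_seq_def by blast
qed

lemma stays_replicate_one: "0 \<le> x \<Longrightarrow> stays {0..} x (replicate n 1)"
  by (induction n arbitrary: x) auto

lemma cons_nonneg: "i \<in> types \<Longrightarrow> 0 \<le> cons1 i \<and> 0 \<le> cons2 i"
  by (auto simp: types_eq)

lemma rew_le: "i \<in> types \<Longrightarrow> rew i \<le> 5"
  by (auto simp: types_eq)

text \<open>Reject everything in the block \<open>w0\<close>, exactly the types in \<open>C\<close> in the block \<open>v\<close>, and nothing
  in the rest \<open>w\<close>.\<close>

lemma hindsight_lower:
  assumes w0: "set w0 \<subseteq> types"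
    and stays1: "stays {0..} (real (length w0)) (map (\<lambda>i. net1 i + cons1 i * of_bool (i \<in> C)) v @ map net1 w)"
    and stays2: "stays {0..} (real (length w0)) (map (\<lambda>i. net2 i + cons2 i * of_bool (i \<in> C)) v @ map net2 w)"
  shows "sum_list (map rew (w0 @ v @ w)) - 5 * real (length w0)
      - sum_list (map (\<lambda>i. rew i * of_bool (i \<in> C)) v) \<le> hindsight (w0 @ v @ w)"
proof -
  define xs where "xs = replicate (length w0) False @ map (\<lambda>i. i \<notin> C) v @ replicate (length w) True"
  have len: "length xs = length (w0 @ v @ w)" by (simp add: xs_def)
  have split: "map2 h (w0 @ v @ w) xs = map (\<lambda>i. h i False) w0 @ map (\<lambda>i. h i (i \<notin> C)) v
      @ map (\<lambda>i. h i True) w" for h :: "nat \<Rightarrow> bool \<Rightarrow> real"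
    by (simp add: xs_def zip_replicate2 zip_map2 zip_same_conv_map)
  have nets: "net1 = (\<lambda>i. 1 - cons1 i)" "net2 = (\<lambda>i. 1 - cons2 i)"
    by (auto simp: net1_def net2_def)
  have eq: "(\<lambda>i. 1 - f i * ind (i \<notin> C)) = (\<lambda>i. 1 - f i + f i * of_bool (i \<in> C))" for f :: "nat \<Rightarrow> real"
    by (auto simp: ind_def)
  \<comment> \<open>Rejecting \<open>w0\<close> stores one unit of each resource per period, the
    starting height of both walks; a rejection in \<open>v\<close> adds the consumption back to the
    increment.\<close>
  have "feasible_seq (w0 @ v @ w) xs"
    unfolding feasible_seq_iff_stays[OF len] split
    using stays1 stays2 unfolding nets
    by (simp add: stays_append[of _ _ "replicate _ _"] stays_replicate_one sum_list_replicate
        ind_def map_replicate_const eq[unfolded ind_def])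
  then have "reward (w0 @ v @ w) xs \<le> hindsight (w0 @ v @ w)" by (rule hindsight_upper[OF len])
  moreover have "reward (w0 @ v @ w) xs = sum_list (map2 (\<lambda>i x. rew i * ind x) (w0 @ v @ w) xs)"
    using len by (simp add: reward_def sum_list_sum_nth atLeast0LessThan)
  moreover have "\<dots> = sum_list (map rew (v @ w)) - sum_list (map (\<lambda>i. rew i * of_bool (i \<in> C)) v)"
    unfolding split by (simp add: ind_def flip: sum_list_subtractf)
      (intro arg_cong[of _ _ sum_list] map_cong; auto)
  moreover have "sum_list (map rew w0) \<le> 5 * real (length w0)"
    using sum_list_mono[of w0 rew "\<lambda>_. 5"] w0 rew_le by (auto simp: sum_list_triv mult.commute)
  ultimately show ?thesis by simp
qed


section \<open>The two continuations\<close>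

definition tube :: "real \<Rightarrow> real list \<Rightarrow> bool" where "tube b s \<longleftrightarrow> stays {-b..b} 0 s"

text \<open>The lower barrier limits the stock needed to accept everything; the upper bound on the
  endpoint forces rejections.\<close>

definition drops :: "real \<Rightarrow> real \<Rightarrow> real list \<Rightarrow> bool" where
  "drops D b s \<longleftrightarrow> stays {-(D + b)..} 0 s \<and> sum_list s \<le> b - D"

text \<open>The product of the two walks is controlled as well because, together with the length, the
  three endpoints determine how many orders of each resource usage occur.\<close>

definition balanced :: "real \<Rightarrow> nat list \<Rightarrow> bool" where
  "balanced b v \<longleftrightarrow> tube b (map net1 v) \<and> tube b (map net2 v) \<and> tube b (map (\<lambda>i. net1 i * net2 i) v)"

text \<open>Marks orders using resource 1 alone, whose rejections the two continuations judge in
  opposite ways.\<close>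

definition usage1 :: "nat \<Rightarrow> real" where "usage1 i = of_bool (i \<in> {1, 3})"

lemma usage1_nonneg: "0 \<le> usage1 i"
  by (simp add: usage1_def)

text \<open>On \<open>types\<close>, \<open>(1 - net1 i) * (1 - net2 i)\<close> is \<open>4\<close>
  if both resources are used and \<open>0\<close> otherwise;
  \<open>(1 - net1 i) * (1 + net2 i)\<close> does the same for resource 1 alone.\<close>

lemma usage_counts:
  assumes "set v \<subseteq> types"
  shows "4 * sum_list (map (\<lambda>i. of_bool (i = 0)) v) = real (length v) - sum_list (map net1 v)
      - sum_list (map net2 v) + sum_list (map (\<lambda>i. net1 i * net2 i) v)"
    and "4 * sum_list (map usage1 v) = real (length v) - sum_list (map net1 v)
      + sum_list (map net2 v) - sum_list (map (\<lambda>i. net1 i * net2 i) v)"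
  using assms by (induction v) (auto simp: types_eq usage1_def)

lemma tube_end: "tube b s \<Longrightarrow> - b \<le> sum_list s \<and> sum_list s \<le> b"
  using stays_end[of "{-b..b}" 0 s] by (simp add: tube_def)

lemma drops_end: "drops D b s \<Longrightarrow> - (D + b) \<le> sum_list s \<and> sum_list s \<le> b - D"
  using stays_end[of "{-(D + b)..}" 0 s] by (simp add: drops_def)

lemma stays_nonneg_if_tube: "tube b s \<Longrightarrow> b \<le> x \<Longrightarrow> stays {0..} x s"
  unfolding tube_def by (erule stays_shift[where d = x]) auto

lemma stays_nonneg_if_drops: "drops D b s \<Longrightarrow> D + b \<le> x \<Longrightarrow> stays {0..} x s"
  unfolding drops_def by (auto intro: stays_shift[where d = x])

lemma stays_nonneg_map_mono:
  assumes "tube b (map f v)" and "b \<le> x" and "\<And>i. i \<in> set v \<Longrightarrow> f i \<le> g i"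
  shows "stays {0..} x (map g v)"
  using stays_map_mono[OF stays_nonneg_if_tube[OF assms(1,2)] order.refl assms(3)] .

text \<open>The buffer \<open>3 * b\<close> covers an error \<open>b\<close> in each of
  \<open>v\<close>, \<open>w1\<close> and the last block. Each of the two usage classes counted in
  \<open>usage_counts\<close> occurs in \<open>v\<close> at least
  \<open>(803 - 3) / 4 * b = 200 * b\<close> times; at two units per order, rejecting it saves the
  \<open>400 * b\<close> units lost in a drop.\<close>

definition scenario :: "real \<Rightarrow> nat list \<Rightarrow> nat list \<Rightarrow> nat list \<Rightarrow> bool" where
  "scenario b w0 v w1 \<longleftrightarrow> 0 < b \<and> set (w0 @ v @ w1) \<subseteq> types \<and> real (length w0) = 3 * b \<and> real (length v) = 803 * b \<and>
     balanced b v \<and> drops (400 * b) b (map net1 w1) \<and> tube b (map net2 w1)"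

lemma scenario_end:
  assumes "scenario b w0 v w1"
  shows "sum_list (map net1 (w0 @ v @ w1)) \<le> - 395 * b" and "sum_list (map net2 (w0 @ v @ w1)) \<le> 5 * b"
proof -
  have "sum_list (map net1 w0) \<le> sum_list (map (\<lambda>_. 1) w0)" "sum_list (map net2 w0) \<le> sum_list (map (\<lambda>_. 1) w0)"
    using assms by (auto intro!: sum_list_mono simp: scenario_def types_eq)
  then show "sum_list (map net1 (w0 @ v @ w1)) \<le> - 395 * b" and "sum_list (map net2 (w0 @ v @ w1)) \<le> 5 * b"
    using assms by (auto simp: scenario_def balanced_def sum_list_triv dest!: tube_end drops_end)
qed

text \<open>If resource 2 becomes scarce too, the orders using both resources should have been rejected.
  The dual prices are \<open>1\<close> and \<open>3/2\<close> per unit.\<close>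

lemma gap_if_drop:
  assumes sc: "scenario b w0 v w1" and w2: "set w2 \<subseteq> types"
    and walks: "tube b (map net1 w2)" "drops (400 * b) b (map net2 w2)"
    and feasible: "feasible_seq (w0 @ v @ w1 @ w2) xs"
  shows "rejected usage1 (w0 @ v @ w1) xs - 37 * b
    \<le> hindsight (w0 @ v @ w1 @ w2) - reward (w0 @ v @ w1 @ w2) xs"
proof -
  note sc' = sc[unfolded scenario_def balanced_def]
  define u where "u = w0 @ v @ w1"
  define c :: real where "c = sum_list (map (\<lambda>i. of_bool (i = 0)) v)"
  have types: "set (u @ w2) \<subseteq> types" using sc' w2 by (auto simp: u_def)
  have c: "200 * b \<le> c" "c \<le> 201.5 * b"
    using usage_counts(1)[of v] sc' by (auto simp: c_def dest!: tube_end)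
  have add: "sum_list (map (\<lambda>i. f i + g i * of_bool (i \<in> {0})) v) = sum_list (map f v) + g 0 * c"
    for f g :: "nat \<Rightarrow> real"
    unfolding c_def by (induction v) (auto simp: algebra_simps of_bool_def)
  have ends: "- b \<le> sum_list (map net1 v)" "- b \<le> sum_list (map net2 v)"
    "- 401 * b \<le> sum_list (map net1 w1)" "- b \<le> sum_list (map net2 w1)"
    using sc' by (auto dest!: tube_end drops_end)
  \<comment> \<open>After \<open>v\<close> both resources have at least
    \<open>(3 - 1 + 400) * b\<close>. A drop costs at most \<open>401 * b\<close> and a tube at most
    \<open>b\<close>, in either order.\<close>
  have stays: "stays {0..} (real (length w0)) (map (\<lambda>i. net1 i + cons1 i * of_bool (i \<in> {0})) v @ map net1 (w1 @ w2))"
    "stays {0..} (real (length w0)) (map (\<lambda>i. net2 i + cons2 i * of_bool (i \<in> {0})) v @ map net2 (w1 @ w2))"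
    unfolding stays_append map_append add
    by (intro conjI stays_nonneg_map_mono[of b net1 v] stays_nonneg_map_mono[of b net2 v]
        stays_nonneg_if_drops[of "400 * b" b "map net1 w1"] stays_nonneg_if_tube[of b "map net2 w1"]
        stays_nonneg_if_tube[of b "map net1 w2"] stays_nonneg_if_drops[of "400 * b" b "map net2 w2"];
        use sc' walks c ends in \<open>auto simp: usage1_nonneg intro!: mult_nonneg_nonneg dest: cons_nonneg\<close>)+
  have "sum_list (map rew (w0 @ v @ w1 @ w2)) - 5 * (3 * b) - 5 * c \<le> hindsight (w0 @ v @ w1 @ w2)"
    using hindsight_lower[OF _ stays] sc' add[of "\<lambda>_. 0" rew] by auto
  \<comment> \<open>At these prices an order using resource 1 alone costs \<open>2\<close> but earns
    \<open>3\<close> or \<open>4\<close>, so rejecting it wastes at least \<open>1\<close>; no other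
    type earns less than its price.\<close>
  moreover have "1 * (1 * rejected cons1 (u @ w2) xs + 3/2 * rejected cons2 (u @ w2) xs)
      + 1 * rejected usage1 (u @ w2) xs \<le> rejected rew (u @ w2) xs"
    unfolding rejected_linear[symmetric] using types by (intro rejected_mono) (auto simp: types_eq usage1_def)
  moreover have "395 * b \<le> rejected cons1 (u @ w2) xs"
  proof -
    have "395 * b \<le> - sum_list (map net1 u)" using scenario_end(1)[OF sc] by (simp add: u_def)
    also have "\<dots> \<le> rejected cons1 u xs" using feasible by (intro rejected_ge_deficit) (simp add: u_def)
    also have "\<dots> \<le> rejected cons1 (u @ w2) xs" using w2 by (intro rejected_prefix) (auto simp: types_eq)
    finally show ?thesis .
  qed
  moreover have "394 * b \<le> rejected cons2 (u @ w2) xs"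
  proof -
    have "394 * b \<le> - sum_list (map net2 (u @ w2))"
      using scenario_end(2)[OF sc] drops_end[OF walks(2)] by (simp add: u_def)
    also have "\<dots> \<le> rejected cons2 (u @ w2) xs"
      using feasible by (intro rejected_ge_deficit[of _ "[]"]) (simp add: u_def)
    finally show ?thesis .
  qed
  moreover have "rejected usage1 u xs \<le> rejected usage1 (u @ w2) xs"
    by (intro rejected_prefix usage1_nonneg)
  \<comment> \<open>In units of \<open>b\<close>: the policy loses at least
    \<open>395 + 3/2 * 394 = 986\<close> plus the waste, hindsight at most
    \<open>15 + 5 * 201.5 = 1022.5\<close>.\<close>
  ultimately show ?thesis using c sc' by (simp add: reward_eq u_def)
qed

text \<open>If resource 2 stays plentiful, only orders using just resource 1 should have been rejected.\<close>

lemma gap_if_tube: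
  assumes sc: "scenario b w0 v w1" and w2: "set w2 \<subseteq> types"
    and walks: "tube b (map net1 w2)" "tube b (map net2 w2)"
    and feasible: "feasible_seq (w0 @ v @ w1 @ w2) xs"
  shows "166 * b - 2 * rejected usage1 (w0 @ v @ w1) xs
    \<le> hindsight (w0 @ v @ w1 @ w2) - reward (w0 @ v @ w1 @ w2) xs"
proof -
  note sc' = sc[unfolded scenario_def balanced_def]
  define u where "u = w0 @ v @ w1"
  define c where "c = sum_list (map usage1 v)"
  have types: "set u \<subseteq> types" and vtypes: "set v \<subseteq> types" using sc' by (auto simp: u_def)
  have c: "200 * b \<le> c" "c \<le> 201.5 * b"
    using usage_counts(2)[of v] sc' by (auto simp: c_def dest!: tube_end)
  have add: "sum_list (map (\<lambda>i. net1 i + cons1 i * usage1 i) v) = sum_list (map net1 v) + 2 * c"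
    "sum_list (map (\<lambda>i. net2 i + cons2 i * usage1 i) v) = sum_list (map net2 v)"
    "sum_list (map (\<lambda>i. rew i * usage1 i) v) \<le> 4 * c"
    unfolding c_def using vtypes by (induction v) (auto simp: algebra_simps types_eq usage1_def)
  have ends: "- b \<le> sum_list (map net1 v)" "- b \<le> sum_list (map net2 v)"
    "- 401 * b \<le> sum_list (map net1 w1)" "- b \<le> sum_list (map net2 w1)"
    using sc' by (auto dest!: tube_end drops_end)
  \<comment> \<open>Resource 1 has the same budget as before; for resource 2 the buffer alone covers
    the three tubes.\<close>
  have stays: "stays {0..} (real (length w0)) (map (\<lambda>i. net1 i + cons1 i * usage1 i) v @ map net1 (w1 @ w2))"
    "stays {0..} (real (length w0)) (map (\<lambda>i. net2 i + cons2 i * usage1 i) v @ map net2 (w1 @ w2))"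
    unfolding stays_append map_append add
    by (intro conjI stays_nonneg_map_mono[of b net1 v] stays_nonneg_map_mono[of b net2 v]
        stays_nonneg_if_drops[of "400 * b" b "map net1 w1"] stays_nonneg_if_tube[of b "map net2 w1"]
        stays_nonneg_if_tube[of b "map net1 w2"] stays_nonneg_if_tube[of b "map net2 w2"];
        use sc' walks c ends in \<open>auto simp: usage1_nonneg intro!: mult_nonneg_nonneg dest: cons_nonneg\<close>)+
  have "sum_list (map rew (w0 @ v @ w1 @ w2)) - 5 * (3 * b) - 4 * c \<le> hindsight (w0 @ v @ w1 @ w2)"
    using hindsight_lower[OF _ stays[unfolded usage1_def]] sc' add(3)[unfolded usage1_def] by auto
  \<comment> \<open>Now the prices are \<open>5/2\<close> and \<open>0\<close>: orders using both
    resources earn exactly their price, those using resource 1 alone fall short by at most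
    \<open>2\<close>.\<close>
  moreover have "5/2 * rejected cons1 u xs + (-2) * rejected usage1 u xs \<le> rejected rew u xs"
    unfolding rejected_linear[symmetric] using types by (intro rejected_mono) (auto simp: types_eq usage1_def)
  moreover have "rejected rew u xs \<le> rejected rew (u @ w2) xs"
    using w2 by (intro rejected_prefix) (auto simp: types_eq)
  moreover have "395 * b \<le> rejected cons1 u xs"
  proof -
    have "395 * b \<le> - sum_list (map net1 u)" using scenario_end(1)[OF sc] by (simp add: u_def)
    also have "\<dots> \<le> rejected cons1 u xs" using feasible by (intro rejected_ge_deficit) (simp add: u_def)
    finally show ?thesis .
  qed
  \<comment> \<open>In units of \<open>b\<close>: \<open>5/2 * 395 = 987.5\<close> against at most
    \<open>15 + 4 * 201.5 = 821\<close>.\<close>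
  ultimately show ?thesis using c sc' by (simp add: reward_eq u_def)
qed


section \<open>Probabilities of the scenarios\<close>

lemma prob_nets:
  "orders.expect n (\<lambda>ws. of_bool (P (map net1 ws) \<and> Q (map net2 ws)))
    = coin.expect n (\<lambda>s. of_bool (P s)) * coin.expect n (\<lambda>s. of_bool (Q s))"
  using net_walks_independent[of n "\<lambda>s. of_bool (P s)" "\<lambda>s. of_bool (Q s)"]
  by (simp add: of_bool_conj)

text \<open>All three increments are centred signs, so each walk leaves its tube with probability at
  most \<open>1/6\<close>. The union bound also handles the product walk, which is determined by the
  other two.\<close>

lemma prob_balanced:
  assumes "0 < b" and "6 * real n \<le> b\<^sup>2"
  shows "1 / 2 \<le> orders.expect n (\<lambda>v. of_bool (balanced b v))"
proof -
  let ?F = "\<lambda>z. orders.expect n (\<lambda>v. of_bool (\<not> tube b (map z v)))"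
  have F: "?F z \<le> 1 / 6" if "z \<in> {net1, net2, \<lambda>i. net1 i * net2 i}" for z
  proof -
    have "?F z \<le> (0\<^sup>2 + real n) / b\<^sup>2"
      unfolding tube_def using that assms(1)
      by (intro orders.maximal_inequality) (auto simp: sum_types)
    also have "\<dots> \<le> 1 / 6" using assms by (simp add: field_simps)
    finally show ?thesis .
  qed
  have "1 = orders.expect n (\<lambda>_. 1)" by simp
  also have "\<dots> \<le> orders.expect n (\<lambda>v. of_bool (balanced b v) + (of_bool (\<not> tube b (map net1 v))
      + (of_bool (\<not> tube b (map net2 v)) + of_bool (\<not> tube b (map (\<lambda>i. net1 i * net2 i) v)))))"
    by (intro orders.expect_mono) (auto simp: balanced_def)
  also have "\<dots> = orders.expect n (\<lambda>v. of_bool (balanced b v))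
      + (?F net1 + (?F net2 + ?F (\<lambda>i. net1 i * net2 i)))"
    by (simp only: orders.expect_add)
  finally show ?thesis using F[of net1] F[of net2] F[of "\<lambda>i. net1 i * net2 i"] by simp
qed

text \<open>The scale will be chosen such that the horizon is at most \<open>16000000 b\<^sup>2\<close>; then \<open>\<kappa>\<close> bounds
  every tube probability \<open>exp (- 4 n / b\<^sup>2)\<close> from below.\<close>

definition \<kappa> :: real where "\<kappa> = exp (- 64000000)"

lemma kappa_bounds: "0 < \<kappa>" "\<kappa> \<le> 1"
  by (simp_all add: \<kappa>_def)

context
  fixes b n :: nat
  assumes b: "2 \<le> b" and n_ge: "640000 * b\<^sup>2 \<le> n" and n_le: "n \<le> 16000000 * b\<^sup>2"
begin

lemma kappa_le: "\<kappa> \<le> exp (- 4 * real n / (real b)\<^sup>2)"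
proof -
  have "real n \<le> real (16000000 * b\<^sup>2)" using n_le by (simp only: of_nat_le_iff)
  then have "4 * real n \<le> 64000000 * (real b)\<^sup>2" by simp
  then have "4 * real n / (real b)\<^sup>2 \<le> 64000000" using b by (simp add: divide_le_eq)
  then show ?thesis by (simp add: \<kappa>_def)
qed

lemma prob_tube: "\<kappa> \<le> coin.expect n (\<lambda>s. of_bool (tube (real b) s))"
  unfolding tube_def using order_trans[OF kappa_le tube_ge[of "real b" n]] b by simp

lemma prob_drops: "\<kappa> / 4 \<le> coin.expect n (\<lambda>s. of_bool (drops (400 * real b) (real b) s))"
proof -
  have n: "0 < n" using n_ge b by (auto intro!: gr0I)
  \<comment> \<open>The block is at least twice as long as
    \<open>(400 * real b + 1)\<^sup>2\<close>, which makes the hitting probability at least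
    \<open>1/4\<close>.\<close>
  have "real (640000 * b\<^sup>2) \<le> real n" using n_ge by (simp only: of_nat_le_iff)
  moreover have "(400 * real b + 1)\<^sup>2 \<le> (500 * real b)\<^sup>2" using b by (intro power_mono) auto
  then have "(400 * real b + 1)\<^sup>2 \<le> 250000 * (real b)\<^sup>2" by (simp add: power_mult_distrib)
  moreover have "250000 * (real b)\<^sup>2 \<le> 320000 * (real b)\<^sup>2" by (intro mult_right_mono) auto
  ultimately have "2 * (400 * real b + 1)\<^sup>2 \<le> real n" by simp
  then have "1 / 4 \<le> (1 - (400 * real b + 1)\<^sup>2 / real n) / 2" using n by (simp add: field_simps)
  then have "\<kappa> * (1 / 4) \<le> exp (- 4 * real n / (real b)\<^sup>2) * ((1 - (400 * real b + 1)\<^sup>2 / real n) / 2)"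
    using kappa_le by (intro mult_mono) auto
  also have "\<dots> \<le> coin.expect n (\<lambda>s. of_bool (drops (400 * real b) (real b) s))"
    using drop_ge[of "real b" n "400 * b"] b n by (simp add: drops_def)
  finally show ?thesis by simp
qed

text \<open>Products by independence; two tubes get the same weaker bound, so that both
  continuations carry equal weight.\<close>

lemma prob_two_walks:
  shows "\<kappa>\<^sup>2 / 4 \<le> orders.expect n (\<lambda>ws. of_bool (drops (400 * real b) (real b) (map net1 ws) \<and> tube (real b) (map net2 ws)))"
    and "\<kappa>\<^sup>2 / 4 \<le> orders.expect n (\<lambda>ws. of_bool (tube (real b) (map net1 ws) \<and> drops (400 * real b) (real b) (map net2 ws)))"
    and "\<kappa>\<^sup>2 / 4 \<le> orders.expect n (\<lambda>ws. of_bool (tube (real b) (map net1 ws) \<and> tube (real b) (map net2 ws)))"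
proof -
  note bounds = prob_tube prob_drops kappa_bounds
  have "\<kappa> / 4 \<le> coin.expect n (\<lambda>s. of_bool (tube (real b) s))" using bounds by linarith
  then show "\<kappa>\<^sup>2 / 4 \<le> orders.expect n (\<lambda>ws. of_bool (tube (real b) (map net1 ws) \<and> tube (real b) (map net2 ws)))"
    using mult_mono[of "\<kappa> / 4" "coin.expect n (\<lambda>s. of_bool (tube (real b) s))" \<kappa>] bounds
    by (simp add: prob_nets power2_eq_square)
  show "\<kappa>\<^sup>2 / 4 \<le> orders.expect n (\<lambda>ws. of_bool (drops (400 * real b) (real b) (map net1 ws) \<and> tube (real b) (map net2 ws)))"
    using mult_mono[OF prob_drops prob_tube] bounds by (simp add: prob_nets power2_eq_square)
  show "\<kappa>\<^sup>2 / 4 \<le> orders.expect n (\<lambda>ws. of_bool (tube (real b) (map net1 ws) \<and> drops (400 * real b) (real b) (map net2 ws)))"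
    using mult_mono[OF prob_tube prob_drops] bounds by (simp add: prob_nets power2_eq_square)
qed

end

section \<open>The lower bound\<close>

lemma expected_gap_nonneg:
  assumes "feasible_policy T p" and "set ws \<subseteq> types" "length ws = T"
  shows "0 \<le> expected_gap p ws"
  using expected_gap_ge[OF assms, of "\<lambda>_. 0"] hindsight_upper assms(3) by force

lemma conditional_gap:
  fixes b n :: nat
  assumes p: "feasible_policy (length (w0 @ v @ w1) + n) p" and sc: "scenario (real b) w0 v w1"
    and n: "640000 * b\<^sup>2 \<le> n" "n \<le> 16000000 * b\<^sup>2" and b: "2 \<le> b"
  shows "23 / 4 * \<kappa>\<^sup>2 * real b \<le> orders.expect n (\<lambda>w2. expected_gap p (w0 @ v @ w1 @ w2))"
proof -
  define u where "u = w0 @ v @ w1"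
  define M where "M = rejected usage1 u"
  define g1 where "g1 xs = max 0 (M xs - 37 * real b)" for xs
  define g2 where "g2 xs = max 0 (166 * real b - 2 * M xs)" for xs
  define F1 where "F1 w2 \<longleftrightarrow> tube (real b) (map net1 w2) \<and> drops (400 * real b) (real b) (map net2 w2)" for w2
  define F2 where "F2 w2 \<longleftrightarrow> tube (real b) (map net1 w2) \<and> tube (real b) (map net2 w2)" for w2
  let ?E = "\<lambda>g. \<Sum>xs\<in>dec_seqs (length u). decision_prob p u xs * g xs"
  have dp: "0 \<le> decision_prob p ws xs" for ws xs
    using p by (intro decision_prob_nonneg) (auto simp: feasible_policy_def)
  have g_nonneg: "0 \<le> ?E g1" "0 \<le> ?E g2"
    by (auto intro!: sum_nonneg mult_nonneg_nonneg dp simp: g1_def g2_def)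
  \<comment> \<open>The sum is smallest at \<open>M xs = 83 * real b\<close>, where
    \<open>g2\<close> vanishes.\<close>
  have g_sum: "46 * real b \<le> g1 xs + g2 xs" for xs
    by (auto simp: g1_def g2_def)
  have "46 * real b = (\<Sum>xs\<in>dec_seqs (length u). decision_prob p u xs * (46 * real b))"
    by (simp add: decision_prob_sum flip: sum_distrib_right)
  also have "\<dots> \<le> (\<Sum>xs\<in>dec_seqs (length u). decision_prob p u xs * (g1 xs + g2 xs))"
    by (intro sum_mono mult_left_mono g_sum dp)
  finally have E: "46 * real b \<le> ?E g1 + ?E g2" by (simp add: distrib_left sum.distrib)
  have "23 / 4 * \<kappa>\<^sup>2 * real b = (46 * real b) / 2 * (\<kappa>\<^sup>2 / 4)" by simp
  also have "\<dots> \<le> (?E g1 + ?E g2) / 2 * (\<kappa>\<^sup>2 / 4)"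
    using E by (intro mult_right_mono) auto
  also have "\<dots> = ?E g1 / 2 * (\<kappa>\<^sup>2 / 4) + ?E g2 / 2 * (\<kappa>\<^sup>2 / 4)"
    by (simp add: add_divide_distrib distrib_right)
  also have "\<dots> \<le> ?E g1 / 2 * orders.expect n (\<lambda>w2. of_bool (F1 w2))
      + ?E g2 / 2 * orders.expect n (\<lambda>w2. of_bool (F2 w2))"
    unfolding F1_def F2_def using g_nonneg b n
    by (intro add_mono mult_left_mono prob_two_walks) auto
  also have "\<dots> = orders.expect n (\<lambda>w2. ?E g1 / 2 * of_bool (F1 w2) + ?E g2 / 2 * of_bool (F2 w2))"
    by (simp only: orders.expect_add orders.expect_cmult)
  also have "\<dots> \<le> orders.expect n (\<lambda>w2. expected_gap p (w0 @ v @ w1 @ w2))"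
  proof (rule orders.expect_mono)
    fix w2 assume w2: "set w2 \<subseteq> types" "length w2 = n"
    \<comment> \<open>The average of the two bounds is valid whichever of the events hold, because
      the gap is nonnegative.\<close>
    define h where "h xs = (of_bool (F1 w2) * g1 xs + of_bool (F2 w2) * g2 xs) / 2" for xs
    have "?E g1 / 2 * of_bool (F1 w2) + ?E g2 / 2 * of_bool (F2 w2) = ?E h"
      unfolding h_def sum_divide_distrib sum_distrib_right sum.distrib[symmetric]
      by (intro sum.cong refl) (simp add: field_simps)
    \<comment> \<open>Non-anticipation enters here: the means of \<open>g1\<close> and
      \<open>g2\<close> are the same for every \<open>w2\<close>.\<close>
    also have "\<dots> = (\<Sum>xs\<in>dec_seqs (length u + length w2). decision_prob p (u @ w2) xs * h (take (length u) xs))"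
      by (simp only: decision_prob_marginal)
    also have "\<dots> \<le> expected_gap p (u @ w2)"
      unfolding w2(2)
    proof (rule expected_gap_ge)
      show "feasible_policy (length u + n) p" using p by (simp add: u_def)
      show "set (u @ w2) \<subseteq> types" "length (u @ w2) = length u + n"
        using w2 sc by (auto simp: u_def scenario_def)
      fix xs :: "bool list" assume xs: "length xs = length u + n" "feasible_seq (u @ w2) xs"
      have M: "M (take (length u) xs) = M xs" by (simp add: M_def rejected_take)
      have feasible: "feasible_seq (w0 @ v @ w1 @ w2) xs" using xs by (simp add: u_def)
      have "0 \<le> hindsight (u @ w2) - reward (u @ w2) xs"
        using hindsight_upper[OF _ xs(2)] xs(1) w2 by simp
      moreover have "M xs - 37 * real b \<le> hindsight (u @ w2) - reward (u @ w2) xs" if "F1 w2"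
        using gap_if_drop[OF sc w2(1) _ _ feasible] that by (simp add: F1_def M_def u_def)
      moreover have "166 * real b - 2 * M xs \<le> hindsight (u @ w2) - reward (u @ w2) xs" if "F2 w2"
        using gap_if_tube[OF sc w2(1) _ _ feasible] that by (simp add: F2_def M_def u_def)
      ultimately show "h (take (length u) xs) \<le> hindsight (u @ w2) - reward (u @ w2) xs"
        unfolding h_def g1_def g2_def M by (cases "F1 w2"; cases "F2 w2") auto
    qed
    finally show "?E g1 / 2 * of_bool (F1 w2) + ?E g2 / 2 * of_bool (F2 w2)
        \<le> expected_gap p (w0 @ v @ w1 @ w2)" by (simp add: u_def)
  qed
  finally show ?thesis .
qed

lemma regret_ge:
  fixes b n1 n2 :: nat
  assumes p: "feasible_policy (3 * b + (803 * b + (n1 + n2))) p" and b: "4818 \<le> b"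
    and n1: "640000 * b\<^sup>2 \<le> n1" "n1 \<le> 16000000 * b\<^sup>2"
    and n2: "640000 * b\<^sup>2 \<le> n2" "n2 \<le> 16000000 * b\<^sup>2"
  shows "\<kappa> ^ 4 / 2 * real b \<le> regret (3 * b + (803 * b + (n1 + n2))) p"
proof -
  define G where "G w1 \<longleftrightarrow> drops (400 * real b) (real b) (map net1 w1) \<and> tube (real b) (map net2 w1)" for w1
  define K where "K = 23 / 4 * \<kappa>\<^sup>2 * real b"
  have K: "0 \<le> K" by (simp add: K_def)
  have inner: "orders.expect n1 (\<lambda>w1. K * of_bool (balanced (real b) v) * of_bool (G w1))
      = (K * orders.expect n1 (\<lambda>w1. of_bool (G w1))) * of_bool (balanced (real b) v)" for v
    unfolding orders.expect_cmult by (simp only: mult_ac)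
  have "\<kappa> ^ 4 / 2 * real b \<le> 23 / 32 * \<kappa> ^ 4 * real b"
    using kappa_bounds by (intro mult_right_mono) auto
  also have "\<dots> = K * (1 / 2) * (\<kappa>\<^sup>2 / 4)"
    by (simp add: K_def power_numeral_reduce field_simps)
  also have "\<dots> \<le> K * orders.expect (803 * b) (\<lambda>v. of_bool (balanced (real b) v))
      * orders.expect n1 (\<lambda>w1. of_bool (G w1))"
  proof (intro mult_mono mult_left_mono prob_balanced mult_nonneg_nonneg K orders.expect_nonneg)
    \<comment> \<open>\<open>4818 = 6 * 803\<close>, as \<open>prob_balanced\<close> requires for
      the block \<open>v\<close>.\<close>
    have "4818 * real b \<le> real b * real b" using b by (intro mult_right_mono) auto
    then show "6 * real (803 * b) \<le> (real b)\<^sup>2" by (simp add: power2_eq_square)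
    show "\<kappa>\<^sup>2 / 4 \<le> orders.expect n1 (\<lambda>w1. of_bool (G w1))"
      unfolding G_def using b n1 by (intro prob_two_walks) auto
  qed (use b in auto)
  also have "\<dots> = orders.expect (3 * b) (\<lambda>w0. orders.expect (803 * b) (\<lambda>v. orders.expect n1 (\<lambda>w1.
      K * of_bool (balanced (real b) v) * of_bool (G w1))))"
    unfolding inner by (simp only: orders.expect_cmult orders.expect_const) (simp only: mult_ac)
  also have "\<dots> \<le> orders.expect (3 * b) (\<lambda>w0. orders.expect (803 * b) (\<lambda>v. orders.expect n1 (\<lambda>w1.
      orders.expect n2 (\<lambda>w2. expected_gap p (w0 @ v @ w1 @ w2)))))"
  proof (intro orders.expect_mono)
    fix w0 v w1
    assume ws: "set w0 \<subseteq> types" "length w0 = 3 * b" "set v \<subseteq> types" "length v = 803 * b"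
      "set w1 \<subseteq> types" "length w1 = n1"
    have p': "feasible_policy (length (w0 @ v @ w1) + n2) p" using p ws by (simp add: ac_simps)
    show "K * of_bool (balanced (real b) v) * of_bool (G w1)
        \<le> orders.expect n2 (\<lambda>w2. expected_gap p (w0 @ v @ w1 @ w2))"
    proof (cases "balanced (real b) v \<and> G w1")
      case True
      then have "scenario (real b) w0 v w1" using ws b by (auto simp: scenario_def G_def)
      then show ?thesis using conditional_gap[OF p' _ n2] True b by (simp add: K_def)
    next
      case False
      have "0 \<le> orders.expect n2 (\<lambda>w2. expected_gap p (w0 @ v @ w1 @ w2))"
        using ws by (intro orders.expect_nonneg expected_gap_nonneg[OF p']) auto
      with False show ?thesis by auto
    qed
  qed
  also have "\<dots> = regret (3 * b + (803 * b + (n1 + n2))) p"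
    by (simp only: regret_eq_expect orders.expect_append append_assoc)
  finally show ?thesis .
qed

lemma regret_ge_sqrt:
  assumes T: "10 ^ 14 < real T" and p: "feasible_policy T p"
  shows "\<kappa> ^ 4 / 8000 * sqrt (real T) \<le> regret T p"
proof -
  \<comment> \<open>This scale gives
    \<open>4000000 * b\<^sup>2 \<le> T \<le> 16000000 * b\<^sup>2\<close>, which leaves room for two
    blocks of at least \<open>640000 * b\<^sup>2\<close> periods and keeps \<open>\<kappa>\<close>
    valid. Beyond \<open>10 ^ 14\<close>, \<open>sqrt T / 2000\<close> exceeds \<open>5000\<close>,
    hence \<open>b \<ge> 4818\<close>.\<close>
  define b where "b = nat \<lfloor>sqrt (real T) / 2000\<rfloor>"
  have "sqrt (10 ^ 14) < sqrt (real T)" using T by (simp only: real_sqrt_less_iff)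
  moreover have "sqrt (10 ^ 14) = (10 ^ 7 :: real)" by (rule real_sqrt_unique) simp_all
  ultimately have root: "10 ^ 7 < sqrt (real T)" by simp
  have b_le: "real b \<le> sqrt (real T) / 2000" and b_gt: "sqrt (real T) / 2000 < real b + 1"
  proof -
    have "real b = real_of_int \<lfloor>sqrt (real T) / 2000\<rfloor>" by (simp add: b_def)
    then show "real b \<le> sqrt (real T) / 2000" "sqrt (real T) / 2000 < real b + 1" by linarith+
  qed
  have "4818 \<le> real b" using root b_gt by simp
  then have b: "4818 \<le> b" by simp
  have "(2000 * real b)\<^sup>2 \<le> (sqrt (real T))\<^sup>2" using b_le by (intro power_mono) auto
  then have "real (4000000 * b\<^sup>2) \<le> real T" by (simp add: power_mult_distrib)
  then have lower: "4000000 * b\<^sup>2 \<le> T" by (simp only: of_nat_le_iff)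
  have "(sqrt (real T))\<^sup>2 \<le> (4000 * real b)\<^sup>2" using b_gt b by (intro power_mono) auto
  then have "real T \<le> real (16000000 * b\<^sup>2)" by (simp add: power_mult_distrib)
  then have upper: "T \<le> 16000000 * b\<^sup>2" by (simp only: of_nat_le_iff)
  define n1 where "n1 = 640000 * b\<^sup>2"
  define n2 where "n2 = T - (3 * b + 803 * b + n1)"
  have "b \<le> b\<^sup>2" using b by (simp add: power2_eq_square)
  then have n2: "640000 * b\<^sup>2 \<le> n2" "n2 \<le> 16000000 * b\<^sup>2" "T = 3 * b + (803 * b + (n1 + n2))"
    using lower upper by (simp_all add: n1_def n2_def)
  \<comment> \<open>Rounding down loses at most a factor \<open>2\<close>, so
    \<open>sqrt (real T) \<le> 4000 * real b\<close>.\<close>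
  have "\<kappa> ^ 4 / 8000 * sqrt (real T) \<le> \<kappa> ^ 4 / 8000 * (4000 * real b)"
    using b_gt b kappa_bounds by (intro mult_left_mono) auto
  also have "\<dots> \<le> regret T p"
    using regret_ge[of b n1 n2 p] p b n2 by (simp add: n1_def mult.commute)
  finally show ?thesis .
qed

theorem theorem3:
  shows "\<exists>T0 > 0. \<exists>c > (0::real). \<forall>T::nat. real T > T0 \<longrightarrow>
           (\<forall>p. feasible_policy T p \<longrightarrow> regret T p \<ge> c * sqrt (real T))"
proof -
  have "0 < \<kappa> ^ 4 / 8000" "(0::real) < 10 ^ 14" using kappa_bounds by simp_all
  with regret_ge_sqrt show ?thesis by blast
qed

end
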